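(* Assume that the Runge-Kutta coefficients $a_{ij}, b_i$ ($i,j=1,\dots,s$) satisfy the symplectic condition $$b_i a_{ij} + b_j a_{ji} - b_i b_j = 0, \qquad b_i \ge 0, \qquad i,j=1,\dots,s.$$ Let $(\phi^n,q^n)_{0\le n\le N}$, together with stage values $(\phi_i^n,q_i^n,k_i^n,l_i^n)$, be a numerical solution of the $s$-stage Runge-Kutta EQ scheme for the Cahn-Hilliard equation (written out in the context), with the consistent initial condition $q^0=(\phi^0)^2-1-C$. Then for every $n=0,1,\dots,N-1$, $$E(\phi^{n+1}) - E(\phi^n) = - \Delta t \sum_{i=1}^s b_i \Big\| \sqrt{M}\, \nabla\Big( -\varepsilon \Delta \phi_i^n + \frac{1}{\varepsilon}\phi_i^n (q_i^n + C)\Big)\Big\|^2 \le 0,$$ where $$E(\phi) = \int_\Omega \Big[\frac{\varepsilon}{2}|\nabla\phi|^2 + \frac{1}{4\varepsilon}(\phi^2-1)^2\Big]\, d\mathbf{x}$$ is the original Cahn-Hilliard free energy.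
   Context: Setting: $\Omega$ is a periodic box (periodic boundary conditions are imposed on all functions), $M\ge 0$ and $\varepsilon>0$ are real constants, and $C\in\mathbb{R}$ is an arbitrary fixed constant. All functions of $\mathbf{x}\in\Omega$ appearing below are real-valued, periodic and smooth. $\|\cdot\|$ is the $L^2(\Omega)$ norm (for vector fields, $\|v\|^2=\int_\Omega |v|^2\,d\mathbf{x}$). Time is discretized by $t_n=n\Delta t$, $\Delta t=T/N$, $T>0$, $n=0,\dots,N$. The Cahn-Hilliard equation is $\partial_t\phi = M\Delta\mu$, $\mu=-\varepsilon\Delta\phi+\frac1\varepsilon(\phi^3-\phi)$; with the auxiliary variable $q=\phi^2-1-C$ it is reformulated as $\partial_t\phi=M\Delta\mu$, $\mu=-\varepsilon\Delta\phi+\frac1\varepsilon\phi(q+C)$, $\partial_t q=2\phi\,\partial_t\phi$. $s$-stage Runge-Kutta EQ scheme: let $a_{ij},b_i$ ($i,j=1,\dots,s$) be real numbers. Start from a given $\phi^0$ and $q^0=(\phi^0)^2-1-C$. Given $(\phi^n,q^n)$, the pair $(\phi^{n+1},q^{n+1})$ is determined by $$\phi^{n+1}=\phi^n+\Delta t\sum_{i=1}^s b_i k_i^n,\qquad q^{n+1}=q^n+\Delta t\sum_{i=1}^s b_i l_i^n,$$ where the intermediate (stage) functions satisfy, for $i=1,\dots,s$, $$\phi_i^n=\phi^n+\Delta t\sum_{j=1}^s a_{ij}k_j^n,\qquad q_i^n=q^n+\Delta t\sum_{j=1}^s a_{ij}l_j^n,$$ $$k_i^n=M\Delta\Big(-\varepsilon\Delta\phi_i^n+\frac1\varepsilon\phi_i^n(q_i^n+C)\Big),\qquad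 l_i^n=2\phi_i^n k_i^n .$$ A numerical solution means any collection of functions satisfying these equations for all $n=0,\dots,N-1$. *)

theory Defs
  imports "HOL-Analysis.Analysis"
begin

text \<open>
  A periodic box is given by two opposite corners \<open>lo\<close>, \<open>hi\<close> with
  \<open>lo \<bullet> b < hi \<bullet> b\<close> for every coordinate direction \<open>b \<in> Basis\<close>; its dimension is
  that of the Euclidean space \<open>'a\<close>. Functions on the box are represented by their periodic
  extensions to the whole space, so that differential operators need no one-sided derivatives.
\<close>

definition periodic_on_box :: "'a::euclidean_space \<Rightarrow> 'a \<Rightarrow> ('a \<Rightarrow> real) \<Rightarrow> bool" where
  "periodic_on_box lo hi f \<longleftrightarrow>
    (\<forall>b\<in>Basis. \<forall>x. f (x + ((hi - lo) \<bullet> b) *\<^sub>R b) = f x)"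

definition partial_deriv :: "'a::euclidean_space \<Rightarrow> ('a \<Rightarrow> real) \<Rightarrow> 'a \<Rightarrow> real" where
  "partial_deriv b f x = frechet_derivative f (at x) b"

primrec C_k :: "nat \<Rightarrow> ('a::euclidean_space \<Rightarrow> real) \<Rightarrow> bool" where
  "C_k 0 f \<longleftrightarrow> continuous_on UNIV f"
| "C_k (Suc k) f \<longleftrightarrow> f differentiable_on UNIV \<and> (\<forall>b\<in>Basis. C_k k (partial_deriv b f))"

definition smooth :: "('a::euclidean_space \<Rightarrow> real) \<Rightarrow> bool" where
  "smooth f \<longleftrightarrow> (\<forall>k. C_k k f)"

definition smooth_periodic :: "'a::euclidean_space \<Rightarrow> 'a \<Rightarrow> ('a \<Rightarrow> real) \<Rightarrow> bool" where
  "smooth_periodic lo hi f \<longleftrightarrow> smooth f \<and> periodic_on_box lo hi f"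

definition gradient :: "('a::euclidean_space \<Rightarrow> real) \<Rightarrow> 'a \<Rightarrow> 'a" where
  "gradient f x = (\<Sum>b\<in>Basis. partial_deriv b f x *\<^sub>R b)"

definition laplacian :: "('a::euclidean_space \<Rightarrow> real) \<Rightarrow> 'a \<Rightarrow> real" where
  "laplacian f x = (\<Sum>b\<in>Basis. partial_deriv b (partial_deriv b f) x)"

definition L2_norm_box :: "'a::euclidean_space \<Rightarrow> 'a \<Rightarrow> ('a \<Rightarrow> 'b::real_normed_vector) \<Rightarrow> real" where
  "L2_norm_box lo hi v = sqrt (integral (cbox lo hi) (\<lambda>x. (norm (v x))\<^sup>2))"

definition CH_energy :: "'a::euclidean_space \<Rightarrow> 'a \<Rightarrow> real \<Rightarrow> ('a \<Rightarrow> real) \<Rightarrow> real" where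
  "CH_energy lo hi \<epsilon> \<phi> =
    integral (cbox lo hi)
      (\<lambda>x. \<epsilon> / 2 * (norm (gradient \<phi> x))\<^sup>2 + 1 / (4 * \<epsilon>) * ((\<phi> x)\<^sup>2 - 1)\<^sup>2)"

definition EQ_potential ::
    "real \<Rightarrow> real \<Rightarrow> ('a::euclidean_space \<Rightarrow> real) \<Rightarrow> ('a \<Rightarrow> real) \<Rightarrow> 'a \<Rightarrow> real" where
  "EQ_potential \<epsilon> C \<phi> q x = - \<epsilon> * laplacian \<phi> x + 1 / \<epsilon> * \<phi> x * (q x + C)"

definition symplectic_RK :: "nat \<Rightarrow> (nat \<Rightarrow> nat \<Rightarrow> real) \<Rightarrow> (nat \<Rightarrow> real) \<Rightarrow> bool" where
  "symplectic_RK s a b \<longleftrightarrow>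
    (\<forall>i\<in>{1..s}. \<forall>j\<in>{1..s}. b i * a i j + b j * a j i - b i * b j = 0) \<and>
    (\<forall>i\<in>{1..s}. b i \<ge> 0)"

text \<open>
  \<open>\<phi> n\<close>, \<open>q n\<close> are the numerical values at time level \<open>n\<close>; \<open>\<phi>s n i\<close>, \<open>qs n i\<close>, \<open>k n i\<close>,
  \<open>l n i\<close> are the values at stage \<open>i\<close> of the step from level \<open>n\<close> to level \<open>n + 1\<close>.
\<close>

definition RK_EQ_solution ::
    "'a::euclidean_space \<Rightarrow> 'a \<Rightarrow> real \<Rightarrow> real \<Rightarrow> real \<Rightarrow>
     nat \<Rightarrow> (nat \<Rightarrow> nat \<Rightarrow> real) \<Rightarrow> (nat \<Rightarrow> real) \<Rightarrow> real \<Rightarrow> nat \<Rightarrow>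
     (nat \<Rightarrow> 'a \<Rightarrow> real) \<Rightarrow> (nat \<Rightarrow> 'a \<Rightarrow> real) \<Rightarrow>
     (nat \<Rightarrow> nat \<Rightarrow> 'a \<Rightarrow> real) \<Rightarrow> (nat \<Rightarrow> nat \<Rightarrow> 'a \<Rightarrow> real) \<Rightarrow>
     (nat \<Rightarrow> nat \<Rightarrow> 'a \<Rightarrow> real) \<Rightarrow> (nat \<Rightarrow> nat \<Rightarrow> 'a \<Rightarrow> real) \<Rightarrow> bool" where
  "RK_EQ_solution lo hi M \<epsilon> C s a b \<Delta>t N \<phi> q \<phi>s qs k l \<longleftrightarrow>
    (\<forall>n\<le>N. smooth_periodic lo hi (\<phi> n) \<and> smooth_periodic lo hi (q n)) \<and>
    (\<forall>n<N. \<forall>i\<in>{1..s}.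
       smooth_periodic lo hi (\<phi>s n i) \<and> smooth_periodic lo hi (qs n i) \<and>
       smooth_periodic lo hi (k n i) \<and> smooth_periodic lo hi (l n i)) \<and>
    (\<forall>n<N. \<forall>x.
       \<phi> (n + 1) x = \<phi> n x + \<Delta>t * (\<Sum>i=1..s. b i * k n i x) \<and>
       q (n + 1) x = q n x + \<Delta>t * (\<Sum>i=1..s. b i * l n i x)) \<and>
    (\<forall>n<N. \<forall>i\<in>{1..s}. \<forall>x.
       \<phi>s n i x = \<phi> n x + \<Delta>t * (\<Sum>j=1..s. a i j * k n j x) \<and>
       qs n i x = q n x + \<Delta>t * (\<Sum>j=1..s. a i j * l n j x) \<and>
       k n i x = M * laplacian (EQ_potential \<epsilon> C (\<phi>s n i) (qs n i)) x \<and>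
       l n i x = 2 * \<phi>s n i x * k n i x)"

end

theory Submission
  imports Defs
begin

text \<open>
  Call \<open>\<mu>\<^sub>i\<close> the potential of stage \<open>i\<close>. Two facts combine.

  First, a symplectic Runge-Kutta method changes a quadratic form by exactly the weighted sum of its
  rates of change at the stages (\<open>symplectic_RK_norm_increment\<close>): the terms of second order in the
  step size carry the coefficients \<open>b\<^sub>i a\<^sub>i\<^sub>j + b\<^sub>j a\<^sub>j\<^sub>i - b\<^sub>i b\<^sub>j\<close> and vanish. For \<open>\<phi>\<^sup>2\<close> this says that
  the scheme transports \<open>q\<close> and \<open>\<phi>\<^sup>2\<close> by the same increments, since \<open>l\<^sub>i = 2 \<phi>\<^sub>i k\<^sub>i\<close>, so the relation
  \<open>q = \<phi>\<^sup>2 - 1 - C\<close> is inherited from the initial data (\<open>RK_EQ_auxiliary_variable\<close>). The quartic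
  energy density is therefore the quadratic expression \<open>\<epsilon>/2 |\<nabla>\<phi>|\<^sup>2 + (q + C)\<^sup>2/(4\<epsilon>)\<close>, and the same
  identity, applied pointwise to \<open>\<nabla>\<phi>\<close> and to \<open>q + C\<close>, gives its increment over one step as the sum
  over \<open>i\<close> of \<open>\<Delta>t b\<^sub>i (\<epsilon> \<nabla>\<phi>\<^sub>i \<bullet> \<nabla>k\<^sub>i + \<phi>\<^sub>i (q\<^sub>i + C) k\<^sub>i/\<epsilon>)\<close>.

  Second, integration by parts on the periodic box has no boundary terms
  (\<open>integral_gradient_inner\<close>). It turns the \<open>i\<close>-th bracket into \<open>\<integral> \<mu>\<^sub>i k\<^sub>i = M \<integral> \<mu>\<^sub>i \<Delta>\<mu>\<^sub>i\<close>, and a second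
  application gives \<open>-M \<integral> |\<nabla>\<mu>\<^sub>i|\<^sup>2\<close> (\<open>RK_EQ_energy_law\<close>). Non-negative weights then give the sign.

  The vanishing of \<open>\<integral> \<partial>f\<close> for periodic \<open>f\<close>, which underlies the integration by parts, is obtained from
  translation invariance: \<open>\<integral> f(x + t e) dx\<close> over a period cell does not depend on \<open>t\<close>, and its
  derivative at \<open>t = 0\<close> is \<open>\<integral> \<partial>\<^sub>e f\<close>.
\<close>

section \<open>Calculus of smooth periodic functions\<close>

lemma smooth_differentiable: "smooth f \<Longrightarrow> f differentiable (at x)"
  unfolding smooth_def using C_k.simps(2)[of 0 f]
  by (metis differentiable_on_eq_differentiable_at open_UNIV UNIV_I)

lemma smooth_partial_deriv: "smooth f \<Longrightarrow> e \<in> Basis \<Longrightarrow> smooth (partial_deriv e f)"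
  unfolding smooth_def using C_k.simps(2) by blast

lemma smooth_continuous_on: "smooth f \<Longrightarrow> continuous_on S f"
  by (meson smooth_def C_k.simps(1) continuous_on_subset top_greatest)

lemma smooth_has_derivative:
  "smooth f \<Longrightarrow> (f has_derivative frechet_derivative f (at x)) (at x)"
  using smooth_differentiable frechet_derivative_works by blast

lemma partial_deriv_eqI: "(f has_derivative D) (at x) \<Longrightarrow> partial_deriv e f x = D e"
  unfolding partial_deriv_def using frechet_derivative_at by metis

lemma partial_deriv_const: "partial_deriv e (\<lambda>x. c) = (\<lambda>x. 0)"
  by (rule ext, rule partial_deriv_eqI) (rule has_derivative_const)

lemma partial_deriv_add:
  assumes "f differentiable (at x)" "g differentiable (at x)"
  shows "partial_deriv e (\<lambda>x. f x + g x) x = partial_deriv e f x + partial_deriv e g x"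
  using partial_deriv_eqI[OF has_derivative_add] assms frechet_derivative_works
  unfolding partial_deriv_def by blast

lemma partial_deriv_mult:
  assumes "f differentiable (at x)" "g differentiable (at x)"
  shows "partial_deriv e (\<lambda>x. f x * g x) x = partial_deriv e f x * g x + f x * partial_deriv e g x"
  using partial_deriv_eqI[OF has_derivative_mult] assms frechet_derivative_works
  unfolding partial_deriv_def by (simp add: add.commute frechet_derivative_works)

lemma C_k_const: "C_k k (\<lambda>x. c)"
  by (induction k arbitrary: c) (simp_all add: partial_deriv_const)

lemma C_k_add: "C_k k f \<Longrightarrow> C_k k g \<Longrightarrow> C_k k (\<lambda>x. f x + g x)"
proof (induction k arbitrary: f g)
  case (Suc k)
  then have d: "f differentiable (at x)" "g differentiable (at x)" for x
    by (simp_all add: differentiable_on_eq_differentiable_at)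
  then have "partial_deriv e (\<lambda>x. f x + g x) = (\<lambda>x. partial_deriv e f x + partial_deriv e g x)" for e
    by (intro ext partial_deriv_add)
  with Suc d show ?case
    by (simp add: differentiable_on_eq_differentiable_at)
qed (simp add: continuous_on_add)

text \<open>
  The factors are taken smooth instead of \<open>C_k k\<close>: the product rule leaves one factor
  undifferentiated, so an induction that only knew \<open>C_k (Suc k)\<close> would also need that this implies
  \<open>C_k k\<close>, whereas smoothness passes to the function and its derivatives alike.
\<close>
lemma C_k_mult: "smooth f \<Longrightarrow> smooth g \<Longrightarrow> C_k k (\<lambda>x. f x * g x)"
proof (induction k arbitrary: f g)
  case 0
  then show ?case by (simp add: continuous_on_mult smooth_continuous_on)
next
  case (Suc k)
  have "partial_deriv e (\<lambda>x. f x * g x) = (\<lambda>x. partial_deriv e f x * g x + f x * partial_deriv e g x)" for e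
    using Suc.prems by (intro ext partial_deriv_mult smooth_differentiable)
  with Suc show ?case
    by (simp add: differentiable_on_eq_differentiable_at smooth_differentiable
        C_k_add smooth_partial_deriv)
qed

lemma periodic_partial_deriv:
  assumes "smooth f" "periodic_on_box lo hi f"
  shows "periodic_on_box lo hi (partial_deriv e f)"
  unfolding periodic_on_box_def
proof (intro ballI allI)
  fix c x :: 'a assume c: "c \<in> Basis"
  let ?p = "((hi - lo) \<bullet> c) *\<^sub>R c"
  have eq: "(\<lambda>y. f (y + ?p)) = f"
    using assms(2) c by (auto simp: periodic_on_box_def)
  have "((\<lambda>y. f (y + ?p)) has_derivative frechet_derivative f (at (x + ?p))) (at x)"
    by (rule has_derivative_compose[where g = f, OF _ smooth_has_derivative[OF assms(1)], of "\<lambda>y. y + ?p" "\<lambda>y. y", simplified])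
       (auto intro!: derivative_eq_intros)
  then show "partial_deriv e f (x + ?p) = partial_deriv e f x"
    unfolding eq using partial_deriv_eqI partial_deriv_def by metis
qed

lemma smooth_periodic_const: "smooth_periodic lo hi (\<lambda>x. c)"
  by (simp add: smooth_periodic_def smooth_def periodic_on_box_def C_k_const)

lemma smooth_periodic_add:
  "smooth_periodic lo hi f \<Longrightarrow> smooth_periodic lo hi g \<Longrightarrow> smooth_periodic lo hi (\<lambda>x. f x + g x)"
  by (simp add: smooth_periodic_def smooth_def periodic_on_box_def C_k_add)

lemma smooth_periodic_mult:
  "smooth_periodic lo hi f \<Longrightarrow> smooth_periodic lo hi g \<Longrightarrow> smooth_periodic lo hi (\<lambda>x. f x * g x)"
  using C_k_mult[of f g] by (simp add: smooth_periodic_def smooth_def periodic_on_box_def)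

lemma smooth_periodic_sum:
  assumes "\<And>i. i \<in> I \<Longrightarrow> smooth_periodic lo hi (f i)"
  shows "smooth_periodic lo hi (\<lambda>x. \<Sum>i\<in>I. f i x)"
  using assms by (induction I rule: infinite_finite_induct)
    (simp_all add: smooth_periodic_const smooth_periodic_add)

lemma smooth_periodic_partial_deriv:
  "smooth_periodic lo hi f \<Longrightarrow> e \<in> Basis \<Longrightarrow> smooth_periodic lo hi (partial_deriv e f)"
  by (simp add: smooth_periodic_def smooth_partial_deriv periodic_partial_deriv)

lemma smooth_periodic_laplacian:
  "smooth_periodic lo hi f \<Longrightarrow> smooth_periodic lo hi (laplacian f)"
  unfolding laplacian_def[abs_def]
  by (intro smooth_periodic_sum smooth_periodic_partial_deriv)

lemma smooth_periodic_EQ_potential: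
  "smooth_periodic lo hi f \<Longrightarrow> smooth_periodic lo hi g \<Longrightarrow> smooth_periodic lo hi (EQ_potential \<epsilon> C f g)"
  unfolding EQ_potential_def[abs_def]
  by (intro smooth_periodic_add smooth_periodic_mult smooth_periodic_const smooth_periodic_laplacian)

lemma smooth_periodic_differentiable: "smooth_periodic lo hi f \<Longrightarrow> f differentiable (at x)"
  by (simp add: smooth_periodic_def smooth_differentiable)

lemma smooth_periodic_integrable: "smooth_periodic lo hi f \<Longrightarrow> f integrable_on cbox c d"
  by (simp add: smooth_periodic_def smooth_continuous_on integrable_continuous)

lemma gradient_inner_gradient:
  "gradient f x \<bullet> gradient g x = (\<Sum>e\<in>Basis. partial_deriv e f x * partial_deriv e g x)"
  by (simp add: gradient_def inner_sum_left inner_sum_right inner_Basis if_distrib mult.commute cong: if_cong)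

lemma gradient_linear_combination:
  assumes "f differentiable (at x)" "\<And>j. j \<in> J \<Longrightarrow> g j differentiable (at x)"
  shows "gradient (\<lambda>x. f x + h * (\<Sum>j\<in>J. c j * g j x)) x
    = gradient f x + h *\<^sub>R (\<Sum>j\<in>J. c j *\<^sub>R gradient (g j) x)"
proof -
  have "((\<lambda>x. f x + h * (\<Sum>j\<in>J. c j * g j x)) has_derivative
      (\<lambda>v. frechet_derivative f (at x) v + h * (\<Sum>j\<in>J. c j * frechet_derivative (g j) (at x) v))) (at x)"
    using assms
    by (intro has_derivative_add has_derivative_mult_right has_derivative_sum)
       (simp_all add: frechet_derivative_works)
  from partial_deriv_eqI[OF this]
  have "partial_deriv e (\<lambda>x. f x + h * (\<Sum>j\<in>J. c j * g j x)) x
      = partial_deriv e f x + h * (\<Sum>j\<in>J. c j * partial_deriv e (g j) x)" for e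
    by (simp add: partial_deriv_def)
  then have "gradient (\<lambda>x. f x + h * (\<Sum>j\<in>J. c j * g j x)) x =
     gradient f x + h *\<^sub>R (\<Sum>e\<in>Basis. \<Sum>j\<in>J. c j *\<^sub>R partial_deriv e (g j) x *\<^sub>R e)"
    by (simp add: gradient_def algebra_simps sum.distrib scaleR_sum_right scaleR_sum_left sum_distrib_left)
  also have "(\<Sum>e\<in>Basis. \<Sum>j\<in>J. c j *\<^sub>R partial_deriv e (g j) x *\<^sub>R e) = (\<Sum>j\<in>J. c j *\<^sub>R gradient (g j) x)"
    unfolding gradient_def scaleR_sum_right by (rule sum.swap)
  finally show ?thesis .
qed

section \<open>Integration by parts on a periodic box\<close>

lemma integral_cbox_cut:
  fixes f :: "'a::euclidean_space \<Rightarrow> real"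
  assumes f: "f integrable_on cbox u v" and e: "e \<in> Basis" and c: "u \<bullet> e \<le> c" "c \<le> v \<bullet> e"
  shows "integral (cbox u v) f
    = integral (cbox u (v + (c - v \<bullet> e) *\<^sub>R e)) f + integral (cbox (u + (c - u \<bullet> e) *\<^sub>R e) v) f"
proof -
  have coord: "(y + r *\<^sub>R e) \<bullet> d = y \<bullet> d + (if d = e then r else 0)" if "d \<in> Basis" for y :: 'a and r d
    using that e by (simp add: inner_add_left inner_Basis)
  have "(\<Sum>i\<in>Basis. (if i = e then min (v \<bullet> e) c else v \<bullet> i) *\<^sub>R i) = v + (c - v \<bullet> e) *\<^sub>R e"
       "(\<Sum>i\<in>Basis. (if i = e then max (u \<bullet> e) c else u \<bullet> i) *\<^sub>R i) = u + (c - u \<bullet> e) *\<^sub>R e"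
    by (rule euclidean_eqI, use c in \<open>simp add: coord\<close>)+
  then have "cbox u v \<inter> {x. x \<bullet> e \<le> c} = cbox u (v + (c - v \<bullet> e) *\<^sub>R e)"
      "cbox u v \<inter> {x. x \<bullet> e \<ge> c} = cbox (u + (c - u \<bullet> e) *\<^sub>R e) v"
    by (simp_all add: interval_split[OF e])
  moreover note integrable_split[OF f e, of c]
  ultimately show ?thesis
    using e by (intro integral_unique has_integral_split[where k = e and c = c]) (simp_all add: integrable_integral)
qed

text \<open>
  Cut the box stretched by \<open>t\<close> in direction \<open>e\<close> in two ways: into the original box and a slab of
  thickness \<open>t\<close> above it, or into the shifted box and a slab of thickness \<open>t\<close> below it. The slabs
  differ by one period, hence carry the same integral. Both cuts lie inside the
  stretched box for every \<open>t \<ge> 0\<close>, however large compared with the period.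
\<close>
lemma integral_periodic_shift:
  assumes per: "periodic_on_box lo hi f" and cont: "continuous_on UNIV f"
    and e: "e \<in> Basis" and box: "lo \<bullet> e \<le> hi \<bullet> e" and t: "0 \<le> t"
  shows "integral (cbox lo hi) (\<lambda>x. f (x + t *\<^sub>R e)) = integral (cbox lo hi) f"
proof -
  let ?L = "(hi - lo) \<bullet> e" and ?v = "hi + t *\<^sub>R e"
  have int: "f integrable_on cbox u w" for u w
    using cont by (meson continuous_on_subset integrable_continuous top_greatest)
  have ve: "?v \<bullet> e = hi \<bullet> e + t" using e by (simp add: inner_add_left)
  have cut: "?v + (lo \<bullet> e + t - (hi \<bullet> e + t)) *\<^sub>R e = ?v - ?L *\<^sub>R e"
    by (simp add: algebra_simps)
  have "integral (cbox lo ?v) f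
      = integral (cbox lo (?v - ?L *\<^sub>R e)) f + integral (cbox (lo + t *\<^sub>R e) ?v) f"
    using integral_cbox_cut[OF int e, of lo "lo \<bullet> e + t" ?v] box t
    by (simp only: ve cut) (simp add: e inner_add_left)
  moreover have "integral (cbox lo ?v) f
      = integral (cbox lo hi) f + integral (cbox (lo + ?L *\<^sub>R e) ?v) f"
    using integral_cbox_cut[OF int e, of lo "hi \<bullet> e" ?v] box t
    by (simp add: ve inner_diff_left)
  moreover have "integral (cbox (lo + ?L *\<^sub>R e) ?v) f = integral (cbox lo (?v - ?L *\<^sub>R e)) f"
    using integral_shift_cbox[of "lo + ?L *\<^sub>R e" "?L *\<^sub>R e" ?v f] per e
    by (simp add: periodic_on_box_def)
  moreover have "integral (cbox lo hi) (\<lambda>x. f (x + t *\<^sub>R e)) = integral (cbox (lo + t *\<^sub>R e) ?v) f"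
    using integral_shift_cbox[of "lo + t *\<^sub>R e" "t *\<^sub>R e" ?v f] by simp
  ultimately show ?thesis by linarith
qed

text \<open>
  Differentiate the constant function \<open>t \<mapsto> \<integral> f(x + t e) dx\<close> under the integral sign. The interval
  \<open>[0, 1]\<close> for \<open>t\<close> is arbitrary: a one-sided derivative at \<open>0\<close> already determines the value.
\<close>
lemma integral_partial_deriv_periodic:
  assumes f: "smooth_periodic lo hi f" and e: "e \<in> Basis" and box: "lo \<bullet> e \<le> hi \<bullet> e"
  shows "integral (cbox lo hi) (partial_deriv e f) = 0"
proof -
  have smooth: "smooth f" and per: "periodic_on_box lo hi f"
    using f by (auto simp: smooth_periodic_def)
  let ?F = "\<lambda>t. integral (cbox lo hi) (\<lambda>x. f (x + t *\<^sub>R e))"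
  have "(?F has_vector_derivative integral (cbox lo hi) (\<lambda>x. partial_deriv e f (x + 0 *\<^sub>R e)))
      (at 0 within cbox 0 1)"
  proof (rule leibniz_rule_vector_derivative)
    fix t :: real and x :: 'a
    have "((\<lambda>t. f (x + t *\<^sub>R e)) has_derivative
        (\<lambda>s. frechet_derivative f (at (x + t *\<^sub>R e)) (s *\<^sub>R e))) (at t within cbox 0 1)"
      by (rule has_derivative_compose[OF _ smooth_has_derivative[OF smooth]])
         (auto intro!: derivative_eq_intros)
    moreover have "linear (frechet_derivative f (at (x + t *\<^sub>R e)))"
      using linear_frechet_derivative smooth smooth_differentiable by blast
    ultimately show "((\<lambda>t. f (x + t *\<^sub>R e)) has_vector_derivative partial_deriv e f (x + t *\<^sub>R e))
        (at t within cbox 0 1)"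
      by (simp add: has_vector_derivative_def partial_deriv_def linear_cmul)
  next
    show "(\<lambda>x. f (x + t *\<^sub>R e)) integrable_on cbox lo hi" for t
      by (intro integrable_continuous continuous_on_compose2[OF smooth_continuous_on[OF smooth, of UNIV]]
          continuous_intros) auto
    show "continuous_on (cbox 0 1 \<times> cbox lo hi) (\<lambda>(t, x). partial_deriv e f (x + t *\<^sub>R e))"
      unfolding split_beta
      by (intro continuous_on_compose2[OF smooth_continuous_on[OF smooth_partial_deriv[OF smooth e], of UNIV]]
          continuous_intros) auto
  qed auto
  moreover have "(?F has_vector_derivative 0) (at 0 within cbox 0 1)"
    by (rule has_vector_derivative_transform[where f = "\<lambda>t. ?F 0"])
       (use integral_periodic_shift[OF per smooth_continuous_on[OF smooth] e box] in auto)
  ultimately show ?thesis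
    using vector_derivative_unique_within_closed_interval[of 0 1 0] by fastforce
qed

text \<open>
  Green's first identity: the two integrands add up to the divergence of the periodic field
  \<open>g \<nabla>f\<close>, whose integral vanishes.
\<close>
lemma integral_gradient_inner:
  fixes lo hi :: "'a::euclidean_space"
  assumes f: "smooth_periodic lo hi f" and g: "smooth_periodic lo hi g"
    and box: "\<forall>e\<in>Basis. lo \<bullet> e \<le> hi \<bullet> e"
  shows "integral (cbox lo hi) (\<lambda>x. gradient f x \<bullet> gradient g x)
    = - integral (cbox lo hi) (\<lambda>x. laplacian f x * g x)"
proof -
  note sp = smooth_periodic_partial_deriv smooth_periodic_mult smooth_periodic_add
    smooth_periodic_sum smooth_periodic_laplacian f g
  have pw: "gradient f x \<bullet> gradient g x + laplacian f x * g x
      = (\<Sum>e\<in>Basis. partial_deriv e (\<lambda>x. partial_deriv e f x * g x) x)" for x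
  proof -
    have "partial_deriv e (\<lambda>x. partial_deriv e f x * g x) x
        = partial_deriv e (partial_deriv e f) x * g x + partial_deriv e f x * partial_deriv e g x"
      if "e \<in> Basis" for e
      using that by (intro partial_deriv_mult smooth_periodic_differentiable[of lo hi] sp)
    then show ?thesis
      by (simp add: gradient_inner_gradient laplacian_def sum.distrib sum_distrib_right)
  qed
  have "integral (cbox lo hi) (\<lambda>x. gradient f x \<bullet> gradient g x)
        + integral (cbox lo hi) (\<lambda>x. laplacian f x * g x)
      = integral (cbox lo hi) (\<lambda>x. gradient f x \<bullet> gradient g x + laplacian f x * g x)"
    unfolding gradient_inner_gradient
    by (intro integral_add[symmetric] smooth_periodic_integrable[of lo hi] sp)
  also have "\<dots> = (\<Sum>e\<in>Basis. integral (cbox lo hi) (partial_deriv e (\<lambda>x. partial_deriv e f x * g x)))"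
    unfolding pw by (intro integral_sum smooth_periodic_integrable[of lo hi] sp) auto
  also have "\<dots> = 0"
    using box by (intro sum.neutral ballI integral_partial_deriv_periodic sp) auto
  finally show ?thesis by linarith
qed

section \<open>Symplectic Runge-Kutta steps and quadratic forms\<close>

text \<open>
  The classical conservation mechanism for quadratic invariants. Expanding the square produces
  \<open>h\<^sup>2 b\<^sub>i b\<^sub>j (k\<^sub>i \<bullet> k\<^sub>j)\<close>; expressing \<open>u\<close> through the stages produces \<open>-2 h\<^sup>2 b\<^sub>i a\<^sub>i\<^sub>j (k\<^sub>i \<bullet> k\<^sub>j)\<close>.
  After symmetrising in \<open>i, j\<close> the symplectic condition cancels the two. A general inner product
  space is used so that the identity covers both scalars and gradient vectors at a point.
\<close>
lemma symplectic_RK_norm_increment: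
  fixes u :: "'v::real_inner" and k :: "nat \<Rightarrow> 'v"
  assumes symp: "symplectic_RK s a b"
    and stage: "\<And>i. i \<in> {1..s} \<Longrightarrow> U i = u + h *\<^sub>R (\<Sum>j=1..s. a i j *\<^sub>R k j)"
  shows "(norm (u + h *\<^sub>R (\<Sum>i=1..s. b i *\<^sub>R k i)))\<^sup>2 - (norm u)\<^sup>2 = 2 * h * (\<Sum>i=1..s. b i * (U i \<bullet> k i))"
proof -
  let ?S = "\<Sum>i=1..s. b i *\<^sub>R k i"
  let ?A = "\<Sum>i=1..s. \<Sum>j=1..s. b i * a i j * (k i \<bullet> k j)"
  \<comment> \<open>The symplectic condition makes the quadratic terms twice the sum that the stages produce.\<close>
  have "?S \<bullet> ?S = (\<Sum>i=1..s. \<Sum>j=1..s. (b i * b j) * (k i \<bullet> k j))"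
    by (simp add: inner_sum_left inner_sum_right sum_distrib_left mult_ac inner_commute)
  also have "\<dots> = (\<Sum>i=1..s. \<Sum>j=1..s. (b i * a i j + b j * a j i) * (k i \<bullet> k j))"
    using symp unfolding symplectic_RK_def by (intro sum.cong refl arg_cong2[where f = "(*)"]) force
  also have "\<dots> = ?A + (\<Sum>i=1..s. \<Sum>j=1..s. b j * a j i * (k j \<bullet> k i))"
    by (simp add: distrib_right sum.distrib inner_commute)
  also have "(\<Sum>i=1..s. \<Sum>j=1..s. b j * a j i * (k j \<bullet> k i)) = ?A"
    by (rule sum.swap)
  finally have SS: "?S \<bullet> ?S = 2 * ?A" by simp
  have "(\<Sum>i=1..s. b i * (U i \<bullet> k i)) = (\<Sum>i=1..s. b i * (u \<bullet> k i) + h * (\<Sum>j=1..s. b i * a i j * (k i \<bullet> k j)))"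
    by (intro sum.cong refl)
       (simp add: stage inner_add_left inner_sum_left inner_sum_right sum_distrib_left algebra_simps inner_commute)
  also have "\<dots> = u \<bullet> ?S + h * ?A"
    by (simp add: sum.distrib inner_sum_right sum_distrib_left)
  finally show ?thesis
    using SS by (simp add: power2_norm_eq_inner inner_add_left inner_add_right algebra_simps inner_commute)
qed


section \<open>The energy law of the scheme\<close>

text \<open>
  The increments of \<open>\<phi>\<^sup>2\<close> and of \<open>q\<close> over a step are the same weighted sum of \<open>2 \<phi>\<^sub>i k\<^sub>i\<close>, because
  \<open>\<phi>\<^sup>2\<close> is quadratic and the method symplectic. This is why the scheme dissipates the original
  energy and not merely a modified one.
\<close>
lemma RK_EQ_auxiliary_variable:
  assumes symp: "symplectic_RK s a b"
    and scheme: "RK_EQ_solution lo hi M \<epsilon> C s a b \<Delta>t N \<phi> q \<phi>s qs k l"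
    and init: "\<forall>x. q 0 x = (\<phi> 0 x)\<^sup>2 - 1 - C" and "n \<le> N"
  shows "q n x = (\<phi> n x)\<^sup>2 - 1 - C"
  using \<open>n \<le> N\<close>
proof (induction n)
  case 0
  then show ?case using init by simp
next
  case (Suc n)
  then have n: "n < N" by simp
  have "(\<phi> (Suc n) x)\<^sup>2 - (\<phi> n x)\<^sup>2 = 2 * \<Delta>t * (\<Sum>i=1..s. b i * (\<phi>s n i x * k n i x))"
    using symplectic_RK_norm_increment[OF symp, of "\<lambda>i. \<phi>s n i x" "\<phi> n x" \<Delta>t "\<lambda>i. k n i x"] scheme n
    by (simp add: RK_EQ_solution_def)
  moreover have "q (Suc n) x - q n x = \<Delta>t * (\<Sum>i=1..s. b i * (2 * \<phi>s n i x * k n i x))"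
    using scheme n by (simp add: RK_EQ_solution_def)
  ultimately have "(\<phi> (Suc n) x)\<^sup>2 - (\<phi> n x)\<^sup>2 = q (Suc n) x - q n x"
    by (simp add: sum_distrib_left mult_ac)
  with Suc show ?case by simp
qed

text \<open>
  If the square is not integrable, both sides are \<open>0\<close> by the default value of the integral.
\<close>
lemma L2_norm_box_power2:
  "(L2_norm_box lo hi v)\<^sup>2 = integral (cbox lo hi) (\<lambda>x. (norm (v x))\<^sup>2)"
  unfolding L2_norm_box_def
  by (cases "(\<lambda>x. (norm (v x))\<^sup>2) integrable_on cbox lo hi")
    (simp_all add: integral_nonneg not_integrable_integral)

text \<open>
  Once \<open>q + C\<close> replaces \<open>\<phi>\<^sup>2 - 1\<close>, the energy density is quadratic in \<open>(\<nabla>\<phi>, q + C)\<close>, so its increment is known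
  pointwise; each stage contribution then integrates to minus the dissipation of that stage.
\<close>
lemma RK_EQ_energy_law:
  fixes lo hi :: "'a::euclidean_space"
  assumes box: "\<forall>e\<in>Basis. lo \<bullet> e \<le> hi \<bullet> e"
    and M: "M \<ge> 0" and eps: "\<epsilon> > 0"
    and symp: "symplectic_RK s a b"
    and scheme: "RK_EQ_solution lo hi M \<epsilon> C s a b \<Delta>t N \<phi> q \<phi>s qs k l"
    and init: "\<forall>x. q 0 x = (\<phi> 0 x)\<^sup>2 - 1 - C"
    and n: "n < N"
  shows "CH_energy lo hi \<epsilon> (\<phi> (n + 1)) - CH_energy lo hi \<epsilon> (\<phi> n)
      = - \<Delta>t * (\<Sum>i=1..s. b i *
          (L2_norm_box lo hi (\<lambda>x. sqrt M *\<^sub>R gradient (EQ_potential \<epsilon> C (\<phi>s n i) (qs n i)) x))\<^sup>2)"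
proof -
  define \<mu> where "\<mu> i = EQ_potential \<epsilon> C (\<phi>s n i) (qs n i)" for i
  \<comment> \<open>The energy density of the reformulated system, quadratic in the unknowns.\<close>
  define d where "d m x = \<epsilon> / 2 * (norm (gradient (\<phi> m) x))\<^sup>2 + 1 / (4 * \<epsilon>) * (q m x + C)\<^sup>2" for m x
  let ?I = "integral (cbox lo hi)"
  have sp0: "smooth_periodic lo hi (\<phi> m)" "smooth_periodic lo hi (q m)" if "m \<le> N" for m
    using scheme that by (auto simp: RK_EQ_solution_def)
  have sps: "smooth_periodic lo hi (\<phi>s n i)" "smooth_periodic lo hi (qs n i)"
     "smooth_periodic lo hi (k n i)" "smooth_periodic lo hi (l n i)" if "i \<in> {1..s}" for i
    using scheme n that by (auto simp: RK_EQ_solution_def)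
  have stage_\<phi>: "\<phi>s n i = (\<lambda>x. \<phi> n x + \<Delta>t * (\<Sum>j=1..s. a i j * k n j x))" if "i \<in> {1..s}" for i
    using scheme n that by (auto simp: RK_EQ_solution_def)
  have stage_q: "qs n i x = q n x + \<Delta>t * (\<Sum>j=1..s. a i j * l n j x)" if "i \<in> {1..s}" for i x
    using scheme n that by (auto simp: RK_EQ_solution_def)
  have kl: "k n i x = M * laplacian (\<mu> i) x" "l n i x = 2 * \<phi>s n i x * k n i x" if "i \<in> {1..s}" for i x
    using scheme n that by (auto simp: RK_EQ_solution_def \<mu>_def)
  have step: "\<phi> (n + 1) = (\<lambda>x. \<phi> n x + \<Delta>t * (\<Sum>i=1..s. b i * k n i x))"
     "q (n + 1) = (\<lambda>x. q n x + \<Delta>t * (\<Sum>i=1..s. b i * l n i x))"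
    using scheme n by (auto simp: RK_EQ_solution_def)
  note sp = smooth_periodic_const smooth_periodic_partial_deriv smooth_periodic_mult smooth_periodic_add
    smooth_periodic_sum smooth_periodic_laplacian smooth_periodic_EQ_potential sp0 sps
  have sp\<mu>: "smooth_periodic lo hi (\<mu> i)" if "i \<in> {1..s}" for i
    unfolding \<mu>_def by (intro sp that)
  have energy: "CH_energy lo hi \<epsilon> (\<phi> m) = ?I (d m)" if "m \<le> N" for m
  proof -
    have "q m x + C = (\<phi> m x)\<^sup>2 - 1" for x
      using RK_EQ_auxiliary_variable[OF symp scheme init that] by simp
    then show ?thesis by (simp add: CH_energy_def d_def[abs_def])
  qed
  have int_d: "d m integrable_on cbox lo hi" if "m \<le> N" for m
    unfolding d_def[abs_def] power2_norm_eq_inner gradient_inner_gradient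
    unfolding power2_eq_square
    by (intro smooth_periodic_integrable[of lo hi] sp that)
  \<comment> \<open>The rate of change of this density at stage \<open>i\<close>, with \<open>l\<^sub>i = 2 \<phi>\<^sub>i k\<^sub>i\<close> already substituted.\<close>
  define w where "w i x = \<epsilon> * (gradient (\<phi>s n i) x \<bullet> gradient (k n i) x)
      + 1 / \<epsilon> * \<phi>s n i x * (qs n i x + C) * k n i x" for i x
  have density: "d (n + 1) x - d n x = \<Delta>t * (\<Sum>i=1..s. b i * w i x)" for x
  proof -
    have diff: "\<phi> n differentiable (at x)" "\<And>j. j \<in> {1..s} \<Longrightarrow> k n j differentiable (at x)"
      using sp0 sps n smooth_periodic_differentiable less_imp_le by blast+
    have grad: "gradient (\<lambda>x. \<phi> n x + \<Delta>t * (\<Sum>j=1..s. c j * k n j x)) x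
        = gradient (\<phi> n) x + \<Delta>t *\<^sub>R (\<Sum>j=1..s. c j *\<^sub>R gradient (k n j) x)" for c
      using diff by (rule gradient_linear_combination)
    have "(norm (gradient (\<phi> (n + 1)) x))\<^sup>2 - (norm (gradient (\<phi> n) x))\<^sup>2
        = 2 * \<Delta>t * (\<Sum>i=1..s. b i * (gradient (\<phi>s n i) x \<bullet> gradient (k n i) x))"
      unfolding step grad
      by (rule symplectic_RK_norm_increment[OF symp]) (simp only: stage_\<phi> grad)
    moreover have "(q (n + 1) x + C)\<^sup>2 - (q n x + C)\<^sup>2
        = 2 * \<Delta>t * (\<Sum>i=1..s. b i * ((qs n i x + C) * l n i x))"
    proof -
      have next_q: "q (n + 1) x + C = (q n x + C) + \<Delta>t *\<^sub>R (\<Sum>i=1..s. b i *\<^sub>R l n i x)"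
        unfolding step by simp
      have "qs n i x + C = (q n x + C) + \<Delta>t *\<^sub>R (\<Sum>j=1..s. a i j *\<^sub>R l n j x)"
        if "i \<in> {1..s}" for i
        using stage_q[OF that] by simp
      from symplectic_RK_norm_increment[OF symp, OF this] show ?thesis
        by (simp only: next_q real_norm_def power2_abs inner_real_def)
    qed
    ultimately have "d (n + 1) x - d n x
      = \<epsilon> / 2 * (2 * \<Delta>t * (\<Sum>i=1..s. b i * (gradient (\<phi>s n i) x \<bullet> gradient (k n i) x)))
        + 1 / (4 * \<epsilon>) * (2 * \<Delta>t * (\<Sum>i=1..s. b i * ((qs n i x + C) * l n i x)))"
      unfolding d_def by (metis (no_types, lifting) add_diff_add right_diff_distrib)
    also have "\<dots> = \<Delta>t * (\<Sum>i=1..s. b i * w i x)"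
      using eps unfolding w_def sum_distrib_left sum.distrib[symmetric]
      by (intro sum.cong refl) (simp add: kl(2) field_simps)
    finally show ?thesis .
  qed
  have int_w: "w i integrable_on cbox lo hi" if "i \<in> {1..s}" for i
    unfolding w_def[abs_def] gradient_inner_gradient
    by (intro smooth_periodic_integrable[of lo hi] sp that)
  have dissipation: "?I (w i) = - (L2_norm_box lo hi (\<lambda>x. sqrt M *\<^sub>R gradient (\<mu> i) x))\<^sup>2"
    if i: "i \<in> {1..s}" for i
  proof -
    have "?I (w i) = \<epsilon> * ?I (\<lambda>x. gradient (\<phi>s n i) x \<bullet> gradient (k n i) x)
        + ?I (\<lambda>x. 1 / \<epsilon> * \<phi>s n i x * (qs n i x + C) * k n i x)"
      unfolding w_def[abs_def] gradient_inner_gradient integral_mult_right[symmetric]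
      by (intro integral_add smooth_periodic_integrable[of lo hi] sp i)
    also have "\<dots> = ?I (\<lambda>x. - \<epsilon> * (laplacian (\<phi>s n i) x * k n i x))
        + ?I (\<lambda>x. 1 / \<epsilon> * \<phi>s n i x * (qs n i x + C) * k n i x)"
      unfolding integral_gradient_inner[OF sps(1)[OF i] sps(3)[OF i] box] integral_mult_right by simp
    also have "\<dots> = ?I (\<lambda>x. - \<epsilon> * (laplacian (\<phi>s n i) x * k n i x)
        + 1 / \<epsilon> * \<phi>s n i x * (qs n i x + C) * k n i x)"
      by (intro integral_add[symmetric] smooth_periodic_integrable[of lo hi] sp i)
    also have "\<dots> = ?I (\<lambda>x. \<mu> i x * k n i x)"
      by (intro integral_cong) (simp add: \<mu>_def EQ_potential_def algebra_simps)
    also have "\<dots> = M * ?I (\<lambda>x. laplacian (\<mu> i) x * \<mu> i x)"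
      unfolding kl(1)[OF i] integral_mult_right[symmetric] by (simp only: mult_ac)
    also have "\<dots> = - (M * ?I (\<lambda>x. gradient (\<mu> i) x \<bullet> gradient (\<mu> i) x))"
      using integral_gradient_inner[OF sp\<mu>[OF i] sp\<mu>[OF i] box] by simp
    also have "\<dots> = - (L2_norm_box lo hi (\<lambda>x. sqrt M *\<^sub>R gradient (\<mu> i) x))\<^sup>2"
      unfolding L2_norm_box_power2
      using M by (simp add: power_mult_distrib dot_square_norm)
    finally show ?thesis .
  qed
  have "CH_energy lo hi \<epsilon> (\<phi> (n + 1)) - CH_energy lo hi \<epsilon> (\<phi> n) = ?I (\<lambda>x. d (n + 1) x - d n x)"
    using n int_d by (simp add: energy integral_diff)
  also have "\<dots> = \<Delta>t * (\<Sum>i=1..s. b i * ?I (w i))"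
  proof -
    have "?I (\<lambda>x. \<Sum>i=1..s. b i * w i x) = (\<Sum>i=1..s. ?I (\<lambda>x. b i * w i x))"
      using int_w by (intro integral_sum integrable_on_mult_right) auto
    then show ?thesis unfolding density by simp
  qed
  also have "\<dots> = - \<Delta>t * (\<Sum>i=1..s. b i * (L2_norm_box lo hi (\<lambda>x. sqrt M *\<^sub>R gradient (\<mu> i) x))\<^sup>2)"
    by (simp add: dissipation sum_negf)
  finally show ?thesis unfolding \<mu>_def .
qed

theorem theorem3p1:
  fixes lo hi :: "'a::euclidean_space"
    and M \<epsilon> C T \<Delta>t :: real
    and s N :: nat
    and a :: "nat \<Rightarrow> nat \<Rightarrow> real" and b :: "nat \<Rightarrow> real"
    and \<phi> q :: "nat \<Rightarrow> 'a \<Rightarrow> real"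
    and \<phi>s qs k l :: "nat \<Rightarrow> nat \<Rightarrow> 'a \<Rightarrow> real"
  assumes box: "\<forall>e\<in>Basis. lo \<bullet> e < hi \<bullet> e"
    and M: "M \<ge> 0" and eps: "\<epsilon> > 0"
    and time: "T > 0" "N > 0" "\<Delta>t = T / real N"
    and symplectic: "symplectic_RK s a b"
    and scheme: "RK_EQ_solution lo hi M \<epsilon> C s a b \<Delta>t N \<phi> q \<phi>s qs k l"
    and init: "\<forall>x. q 0 x = (\<phi> 0 x)\<^sup>2 - 1 - C"
  shows "\<forall>n<N.
    CH_energy lo hi \<epsilon> (\<phi> (n + 1)) - CH_energy lo hi \<epsilon> (\<phi> n)
      = - \<Delta>t * (\<Sum>i=1..s. b i *
          (L2_norm_box lo hi
            (\<lambda>x. sqrt M *\<^sub>R gradient (EQ_potential \<epsilon> C (\<phi>s n i) (qs n i)) x))\<^sup>2)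
    \<and> - \<Delta>t * (\<Sum>i=1..s. b i *
          (L2_norm_box lo hi
            (\<lambda>x. sqrt M *\<^sub>R gradient (EQ_potential \<epsilon> C (\<phi>s n i) (qs n i)) x))\<^sup>2)
      \<le> 0"
proof (intro allI impI conjI)
  fix n assume n: "n < N"
  show "CH_energy lo hi \<epsilon> (\<phi> (n + 1)) - CH_energy lo hi \<epsilon> (\<phi> n)
      = - \<Delta>t * (\<Sum>i=1..s. b i *
          (L2_norm_box lo hi
            (\<lambda>x. sqrt M *\<^sub>R gradient (EQ_potential \<epsilon> C (\<phi>s n i) (qs n i)) x))\<^sup>2)"
    using box by (intro RK_EQ_energy_law[OF _ M eps symplectic scheme init n]) (simp add: less_imp_le)
  have "\<Delta>t \<ge> 0" using time by simp
  moreover have "b i \<ge> 0" if "i \<in> {1..s}" for i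
    using symplectic that by (simp add: symplectic_RK_def)
  ultimately show "- \<Delta>t * (\<Sum>i=1..s. b i *
          (L2_norm_box lo hi
            (\<lambda>x. sqrt M *\<^sub>R gradient (EQ_potential \<epsilon> C (\<phi>s n i) (qs n i)) x))\<^sup>2) \<le> 0"
    by (simp only: mult_minus_left neg_le_0_iff_le)
       (intro mult_nonneg_nonneg sum_nonneg zero_le_power2)
qed

end
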